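(* There is an absolute constant $c>0$ such that the following holds. Let $p$ be a prime of the form $p=6f+1$, let $g$ be a primitive root modulo $p$, and let $\mathcal{H}=(h_n)_{n\ge 0}$ be Hall's sextic residue sequence of period $p$ with respect to $g$. Then for every integer $N\ge 1$ the $N$th maximum order complexity of $\mathcal{H}$ satisfies $$\log\left(\frac{\min\{N,p\}}{p^{1/2}\log^2 p}\right)\le c\, M(\mathcal{H},N).$$
   Context: Hall's sextic residue sequence: let $p=6f+1$ be a prime and $g$ a primitive root modulo $p$. For $\ell=0,1,\ldots,5$ let $C_\ell=\{g^{6i+\ell} \bmod p : i=0,1,\ldots,f-1\}$ be the cyclotomic cosets modulo $p$ of order $6$. Hall's sextic residue sequence $(h_n)_{n\ge 0}$ of period $p$ with respect to $g$ is defined by $h_n=1$ if $n \bmod p\in C_0\cup C_1\cup C_3$, and $h_n=0$ otherwise (in particular $h_n=0$ if $p\mid n$). $N$th maximum order complexity: for a binary sequence $\mathcal{S}=(s_n)_{n\ge 0}$, viewed over $\mathbb{F}_2$, and an integer $N\ge 1$, $M(\mathcal{S},N)$ is the smallest positive integer $M$ such that there is a polynomial $f(x_1,\ldots,x_M)\in\mathbb{F}_2[x_1,\ldots,x_M]$ with $$s_{i+M}=f(s_i,s_{i+1},\ldots,s_{i+M-1}),\quad 0\le i\le N-M-1$$ (the condition is vacuous if $M\ge N$). $\log$ denotes the natural logarithm and $\log^2 p=(\log p)^2$. The inequality is the written-out form of $M(\mathcal{H},N)=\Omega\left(\log\left(\min\{N,p\}/(p^{1/2}\log^2 p)\right)\right)$,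 where $A=\Omega(B)$ means $B=O(A)$, i.e. $B\le cA$ for a positive absolute constant $c$. *)

theory Defs
  imports Complex_Main "HOL-Library.Z2" "HOL-Library.Poly_Mapping"
    "HOL-Number_Theory.Number_Theory"
begin

(* A multivariate polynomial is a finitely supported map from monomials to coefficients, and a
   monomial is a finitely supported map from variable indices to exponents. *)
type_synonym 'a mvpoly = "(nat \<Rightarrow>\<^sub>0 nat) \<Rightarrow>\<^sub>0 'a"

definition mvpoly_eval :: "(nat \<Rightarrow> 'a) \<Rightarrow> 'a::comm_semiring_1 mvpoly \<Rightarrow> 'a" where
  "mvpoly_eval x F =
     (\<Sum>m\<in>Poly_Mapping.keys F. Poly_Mapping.lookup F m *
        (\<Prod>j\<in>Poly_Mapping.keys m. x j ^ Poly_Mapping.lookup m j))"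

definition mvpoly_vars :: "'a::zero mvpoly \<Rightarrow> nat set" where
  "mvpoly_vars F = (\<Union>m\<in>Poly_Mapping.keys F. Poly_Mapping.keys m)"

(* Variables are numbered from 1, so the variable j takes the value s (i + j - 1).
   The range 0 <= i <= N - M - 1 is written i + M < N to avoid truncated subtraction;
   it is empty iff M >= N. *)
definition has_feedback_poly :: "(nat \<Rightarrow> bit) \<Rightarrow> nat \<Rightarrow> nat \<Rightarrow> bool" where
  "has_feedback_poly s N M \<longleftrightarrow>
     (\<exists>F :: bit mvpoly. mvpoly_vars F \<subseteq> {1..M} \<and>
        (\<forall>i. i + M < N \<longrightarrow> s (i + M) = mvpoly_eval (\<lambda>j. s (i + j - 1)) F))"

definition max_order_complexity :: "(nat \<Rightarrow> bit) \<Rightarrow> nat \<Rightarrow> nat" where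
  "max_order_complexity s N = (LEAST M. 0 < M \<and> has_feedback_poly s N M)"

(* The least element exists: any positive M >= N qualifies. *)
lemma has_feedback_poly_trivial: "N \<le> M \<Longrightarrow> has_feedback_poly s N M"
  unfolding has_feedback_poly_def mvpoly_vars_def by (intro exI[of _ 0]) auto

definition cyclotomic_coset6 :: "nat \<Rightarrow> nat \<Rightarrow> nat \<Rightarrow> nat set" where
  "cyclotomic_coset6 p g l = {g ^ (6 * i + l) mod p | i. i < (p - 1) div 6}"

definition hall_sequence :: "nat \<Rightarrow> nat \<Rightarrow> nat \<Rightarrow> bit" where
  "hall_sequence p g n =
     (if n mod p \<in> cyclotomic_coset6 p g 0 \<union> cyclotomic_coset6 p g 1 \<union> cyclotomic_coset6 p g 3
      then 1 else 0)"

end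

theory Submission
  imports Defs
begin

text \<open>A recurrence of order \<open>M\<close> has only \<open>2 ^ M\<close> states, so the sequence becomes periodic with
  some period \<open>t \<le> 2 ^ M\<close>, hence constant along a progression of difference \<open>t\<close> that stays below
  \<open>min N p\<close>. Modulo \<open>p\<close>, this progression is a sumset \<open>X + Y\<close> of two progressions of equal length,
  and it misses one of the sextic classes. A second moment computation over all \<open>x\<close> modulo \<open>p\<close>, for
  the number of \<open>y \<in> Y\<close> with \<open>x + y\<close> in a given class, shows that the length of \<open>X\<close> and \<open>Y\<close> is
  then \<open>O(\<surd>p)\<close>. No estimate of character sums is needed.\<close>

section \<open>Discrete logarithms and the cyclotomic classes of order 6\<close>

definition discrete_log :: "nat \<Rightarrow> nat \<Rightarrow> nat \<Rightarrow> nat" where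
  "discrete_log p g n = (SOME k. k < p - 1 \<and> g ^ k mod p = n mod p)"

text \<open>Multiples of \<open>p\<close> have no discrete logarithm to a primitive root. Their
  class is an arbitrary number below 6, so statements about classes carry the condition
  \<open>\<not> p dvd n\<close>.\<close>

definition sextic_class :: "nat \<Rightarrow> nat \<Rightarrow> nat \<Rightarrow> nat" where
  "sextic_class p g n = discrete_log p g n mod 6"

lemma discrete_log:
  assumes "prime p" "residue_primroot p g" "\<not> p dvd n"
  shows "discrete_log p g n < p - 1" "g ^ discrete_log p g n mod p = n mod p"
proof -
  have "bij_betw (\<lambda>i. g ^ i mod p) {..<totient p} (totatives p)"
    using assms prime_gt_1_nat by (intro residue_primroot_is_generator) auto
  moreover have "n mod p \<in> totatives p"
    using assms by (simp add: totatives_prime dvd_eq_mod_eq_0 prime_gt_0_nat)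
  ultimately have "\<exists>k. k < p - 1 \<and> g ^ k mod p = n mod p"
    using totient_prime[OF assms(1)] by (force simp: bij_betw_def image_iff)
  then have "discrete_log p g n < p - 1 \<and> g ^ discrete_log p g n mod p = n mod p"
    unfolding discrete_log_def by (rule someI_ex)
  then show "discrete_log p g n < p - 1" "g ^ discrete_log p g n mod p = n mod p" by auto
qed

lemma primroot_power_eq_iff:
  assumes "prime p" "residue_primroot p g"
  shows "[g ^ a = g ^ b] (mod p) \<longleftrightarrow> [a = b] (mod (p - 1))"
  using order_divides_expdiff[of p g a b] assms totient_prime[OF assms(1)]
  by (simp add: residue_primroot_def)

text \<open>Exponents of \<open>g\<close> are determined modulo \<open>p - 1 = 6 * f\<close>, and 6
  divides this, so their residue modulo 6 is well defined.\<close>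

lemma mem_cyclotomic_coset6_iff:
  assumes "prime p" "p = 6 * f + 1" "residue_primroot p g" "l < 6"
  shows "n mod p \<in> cyclotomic_coset6 p g l \<longleftrightarrow> \<not> p dvd n \<and> sextic_class p g n = l"
proof
  assume "n mod p \<in> cyclotomic_coset6 p g l"
  then obtain i where i: "i < f" "n mod p = g ^ (6 * i + l) mod p"
    using assms by (auto simp: cyclotomic_coset6_def)
  have "\<not> p dvd g"
    using assms by (metis coprime_absorb_left not_prime_unit residue_primroot_def)
  then have nd: "\<not> p dvd n"
    using i assms(1) by (metis dvd_eq_mod_eq_0 prime_dvd_power)
  have "[g ^ discrete_log p g n = g ^ (6 * i + l)] (mod p)"
    using discrete_log(2)[OF assms(1,3) nd] i by (simp add: cong_def)
  then have "[discrete_log p g n = 6 * i + l] (mod (p - 1))"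
    using primroot_power_eq_iff assms by blast
  then have "[discrete_log p g n = 6 * i + l] (mod 6)"
    by (rule cong_dvd_modulus_nat) (simp add: assms(2))
  then show "\<not> p dvd n \<and> sextic_class p g n = l"
    using nd assms(4) by (simp add: sextic_class_def cong_def)
next
  assume "\<not> p dvd n \<and> sextic_class p g n = l"
  then have nd: "\<not> p dvd n" and l: "discrete_log p g n mod 6 = l"
    by (auto simp: sextic_class_def)
  have "discrete_log p g n = 6 * (discrete_log p g n div 6) + l" using l by presburger
  moreover have "discrete_log p g n div 6 < f"
    using discrete_log(1)[OF assms(1,3) nd] assms(2) by (simp add: less_mult_imp_div_less mult.commute)
  ultimately show "n mod p \<in> cyclotomic_coset6 p g l"
    using discrete_log(2)[OF assms(1,3) nd] assms(2)
    by (auto simp: cyclotomic_coset6_def intro!: exI[of _ "discrete_log p g n div 6"])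
qed

text \<open>If \<open>x + y\<close> and \<open>x + y'\<close> lie in the same class, their quotient is a sixth power other than
  \<open>1\<close>, and \<open>x\<close> can be recovered from this quotient.\<close>
lemma card_same_sextic_class_le:
  assumes "prime p" "p = 6 * f + 1" "residue_primroot p g" "\<not> [y = y'] (mod p)"
  shows "card {x \<in> {..<p}. \<not> p dvd x + y \<and> \<not> p dvd x + y' \<and>
           sextic_class p g (x + y) = sextic_class p g (x + y')} \<le> f - 1" (is "card ?A \<le> _")
proof -
  \<comment> \<open>\<open>d x\<close> is the discrete logarithm of the quotient of
    \<open>x + y\<close> by \<open>x + y'\<close>. Adding \<open>p - 1\<close> first keeps the
    subtraction on naturals from truncating.\<close>
  define d where "d x = (discrete_log p g (x + y) + (p - 1) - discrete_log p g (x + y')) mod (p - 1)" for x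
  have f: "p - 1 = 6 * f" "f > 0"
    using assms prime_gt_1_nat[of p] by auto
  have d_cong: "[g ^ d x * (x + y') = x + y] (mod p)" if "x \<in> ?A" for x
  proof -
    let ?a = "discrete_log p g (x + y)" and ?b = "discrete_log p g (x + y')"
    have ab: "?b < p - 1" "[g ^ ?a = x + y] (mod p)" "[g ^ ?b = x + y'] (mod p)"
      using that discrete_log[OF assms(1,3)] by (auto simp: cong_def)
    have "[d x + ?b = ?a + (p - 1) - ?b + ?b] (mod (p - 1))"
      unfolding d_def by (intro cong_add) (auto simp: cong_def)
    also have "?a + (p - 1) - ?b + ?b = ?a + (p - 1)" using ab(1) by simp
    also have "[?a + (p - 1) = ?a] (mod (p - 1))" by (simp add: cong_def)
    finally have "[g ^ (d x + ?b) = g ^ ?a] (mod p)"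
      using primroot_power_eq_iff assms by blast
    then have "[g ^ d x * g ^ ?b = x + y] (mod p)"
      using ab by (simp add: power_add) (metis cong_trans)
    then show ?thesis
      using ab(3) by (meson cong_refl cong_mult cong_sym cong_trans)
  qed
  \<comment> \<open>Equal classes make \<open>d x\<close> a multiple of 6 below
    \<open>6 * f\<close>. The value 0 would mean a quotient of 1, that is, \<open>y\<close>
    congruent to \<open>y'\<close>, which leaves \<open>f - 1\<close> values.\<close>
  have image: "d ` ?A \<subseteq> (\<lambda>k. 6 * k) ` {1..<f}"
  proof (intro subsetI, elim imageE)
    fix z x assume x: "z = d x" "x \<in> ?A"
    have b: "discrete_log p g (x + y') < p - 1"
      using x discrete_log[OF assms(1,3)] by auto
    have "[discrete_log p g (x + y) = discrete_log p g (x + y')] (mod 6)"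
      using x by (simp add: sextic_class_def cong_def)
    then have "6 dvd (discrete_log p g (x + y) + (p - 1) - discrete_log p g (x + y'))"
      using b f by (subst mod_eq_dvd_iff_nat[symmetric]) (auto simp: cong_def)
    then have "6 dvd d x"
      unfolding d_def f(1) by (rule dvd_mod) simp
    then obtain k where k: "d x = 6 * k" by blast
    have "d x < p - 1" using f by (simp add: d_def)
    then have "k < f" using k f by simp
    moreover have "k \<noteq> 0"
    proof
      assume "k = 0"
      then have "[x + y' = x + y] (mod p)" using d_cong[OF x(2)] k by simp
      then show False using assms(4) by (metis cong_add_lcancel_nat cong_sym)
    qed
    ultimately show "z \<in> (\<lambda>k. 6 * k) ` {1..<f}" using x k by auto
  qed
  have "inj_on d ?A"
  proof (rule inj_onI)
    fix u v assume uv: "u \<in> ?A" "v \<in> ?A" "d u = d v"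
    define G where "G = int (g ^ d u)"
    have "[G * (int u + int y') = int u + int y] (mod int p)"
      "[G * (int v + int y') = int v + int y] (mod int p)"
      using d_cong[OF uv(1)] d_cong[OF uv(2)] uv(3) unfolding G_def
      by (metis cong_int_iff of_nat_add of_nat_mult)+
    then have "int p dvd (G * (int u + int y') - (int u + int y))"
      "int p dvd (G * (int v + int y') - (int v + int y))"
      by (auto simp: cong_iff_dvd_diff)
    \<comment> \<open>Cross-multiplying eliminates \<open>G\<close>, and what remains factors as
      \<open>(u - v) * (y - y')\<close>.\<close>
    then have "int p dvd (G * (int u + int y') - (int u + int y)) * (int v + int y')
        - (G * (int v + int y') - (int v + int y)) * (int u + int y')"
      by (meson dvd_diff dvd_mult2)
    also have "\<dots> = (int u - int v) * (int y - int y')"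
      by (simp add: algebra_simps)
    finally have "int p dvd (int u - int v) \<or> int p dvd (int y - int y')"
      using assms(1) by (simp add: prime_dvd_mult_iff)
    then have "[u = v] (mod p)"
      using assms(4) by (metis cong_iff_dvd_diff cong_int_iff)
    then show "u = v" using uv by (simp add: cong_def)
  qed
  then have "card ?A \<le> card ((\<lambda>k. 6 * k) ` {1..<f})"
    using image by (rule card_inj_on_le) simp
  also have "\<dots> \<le> card {1..<f}" by (rule card_image_le) simp
  finally show ?thesis by simp
qed

section \<open>Eventual periodicity forced by a feedback polynomial\<close>

lemma mvpoly_eval_cong:
  assumes "\<And>j. j \<in> mvpoly_vars F \<Longrightarrow> x j = y j"
  shows "mvpoly_eval x F = mvpoly_eval y F"
  unfolding mvpoly_eval_def
  by (intro sum.cong prod.cong arg_cong2[where f = "(*)"] arg_cong2[where f = power] refl assms)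
    (auto simp: mvpoly_vars_def)

text \<open>Among the \<open>2 ^ M + 1\<close> windows of length \<open>M\<close> starting at
  \<open>0, ..., 2 ^ M\<close> two coincide, and equal windows have equal continuations. The windows
  are taken from the infinite sequence and may reach past \<open>N\<close>; the recurrence is
  applied only to terms below \<open>N\<close>.\<close>

lemma eventually_periodic_if_feedback_poly:
  assumes "has_feedback_poly s N M"
  shows "\<exists>i t. 0 < t \<and> i + t \<le> 2 ^ M \<and> (\<forall>n. i \<le> n \<and> n + t < N \<longrightarrow> s (n + t) = s n)"
proof -
  obtain F where F: "mvpoly_vars F \<subseteq> {1..M}"
    "\<And>i. i + M < N \<Longrightarrow> s (i + M) = mvpoly_eval (\<lambda>j. s (i + j - 1)) F"
    using assms by (auto simp: has_feedback_poly_def)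
  define st where "st i = map (\<lambda>k. s (i + k)) [0..<M]" for i
  have U: "(UNIV :: bit set) = {0, 1}" by (auto intro: bit.exhaust)
  have "card {xs :: bit list. length xs = M} = 2 ^ M"
    using card_lists_length_eq[of "UNIV :: bit set" M] by (simp add: U[symmetric]) (simp add: U numeral_2_eq_2)
  moreover have "finite {xs :: bit list. length xs = M}"
    using finite_lists_length_eq[of "UNIV :: bit set" M] by (simp add: U[symmetric]) (simp add: U)
  moreover have "st ` {..2 ^ M} \<subseteq> {xs. length xs = M}" by (auto simp: st_def)
  ultimately have "card (st ` {..2 ^ M}) \<le> 2 ^ M" by (metis card_mono)
  then have "\<not> inj_on st {..2 ^ M}" by (intro pigeonhole) simp
  then obtain a b where ab: "a \<le> 2 ^ M" "b \<le> 2 ^ M" "a \<noteq> b" "st a = st b"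
    by (auto simp: inj_on_def)
  define i t where "i = min a b" and "t = max a b - min a b"
  have it: "0 < t" "i + t \<le> 2 ^ M" "st (i + t) = st i"
    using ab by (auto simp: i_def t_def min_def max_def)
  have "s (n + t) = s n" if "i \<le> n" "n + t < N" for n
    using that
  proof (induction n rule: less_induct)
    case (less n)
    show ?case
    proof (cases "n < i + M")
      case True
      then have "n - i < M" using less.prems by simp
      then have "st (i + t) ! (n - i) = s (i + t + (n - i))" "st i ! (n - i) = s (i + (n - i))"
        by (auto simp: st_def)
      then show ?thesis using it less.prems by (simp add: add.commute add.left_commute)
    next
      case False
      define m where "m = n - M"
      have m: "n = m + M" "i \<le> m" using False by (auto simp: m_def)
      have "s (n + t) = s (m + t + M)" by (simp add: m algebra_simps)
      also have "\<dots> = mvpoly_eval (\<lambda>j. s (m + t + j - 1)) F"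
        using less.prems m by (intro F) simp
      also have "\<dots> = mvpoly_eval (\<lambda>j. s (m + j - 1)) F"
      proof (rule mvpoly_eval_cong)
        fix j assume "j \<in> mvpoly_vars F"
        \<comment> \<open>\<open>1 \<le> j\<close> keeps \<open>m + j - 1\<close> from truncating,
          and \<open>j \<le> M\<close> places it below \<open>n\<close>, within reach of the
          induction hypothesis.\<close>
        then have j: "1 \<le> j" "j \<le> M" using F by auto
        then have "s ((m + j - 1) + t) = s (m + j - 1)"
          using less.prems m by (intro less.IH) auto
        then show "s (m + t + j - 1) = s (m + j - 1)" using j by (simp add: algebra_simps)
      qed
      also have "\<dots> = s n" using F(2)[of m] less.prems m by simp
      finally show ?thesis .
    qed
  qed
  then show ?thesis using it by blast
qed

section \<open>The second moment of the class counts\<close>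

text \<open>With \<open>m = card Y - 1\<close>, the six counts \<open>a x l\<close> for a fixed
  \<open>x\<close> have sum of squares at least \<open>m\<^sup>2 / 6\<close>, and at least
  \<open>m\<^sup>2 / 36\<close> more if \<open>x \<in> X\<close>, because one count is then 0.
  Summed over \<open>x\<close>, the squares count colliding pairs from \<open>Y\<close>; off the
  diagonal each pair collides for at most \<open>f - 1 < p / 6\<close> values of \<open>x\<close>.
  The main terms thus nearly cancel, which bounds the excess coming from \<open>X\<close>.\<close>

lemma card_sumset_avoiding_sextic_class:
  assumes "prime p" "p = 6 * f + 1" "residue_primroot p g"
    and XY: "X \<subseteq> {..<p}" "Y \<subseteq> {..<p}" "Y \<noteq> {}" and "l0 < 6"
    and avoid: "\<And>x y. x \<in> X \<Longrightarrow> y \<in> Y \<Longrightarrow> \<not> p dvd x + y \<Longrightarrow> sextic_class p g (x + y) \<noteq> l0"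
  shows "int (card X) * (int (card Y) - 1)\<^sup>2 \<le> 48 * int (card Y) * int p"
proof -
  \<comment> \<open>For each \<open>x\<close> at most one \<open>y \<in> Y\<close> makes
    \<open>x + y\<close> a multiple of \<open>p\<close>, so at least \<open>m\<close> elements are
    counted in the classes.\<close>
  define m where "m = int (card Y) - 1"
  define a where "a x l = int (card {y \<in> Y. \<not> p dvd x + y \<and> sextic_class p g (x + y) = l})" for x l
  define R where "R x z \<longleftrightarrow> (case z of (y, y') \<Rightarrow> \<not> p dvd x + y \<and> \<not> p dvd x + y' \<and>
      sextic_class p g (x + y) = sextic_class p g (x + y'))" for x z
  have fin: "finite X" "finite Y" using XY finite_subset by blast+
  have "card Y > 0" using XY fin by (simp add: card_gt_0_iff)
  then have m_nonneg: "m \<ge> 0" by (simp add: m_def)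
  have sum_sq: "(\<Sum>l<6. (a x l)\<^sup>2) = int (card {z \<in> Y \<times> Y. R x z})" for x
  proof -
    define K where "K l = {y \<in> Y. \<not> p dvd x + y \<and> sextic_class p g (x + y) = l}" for l
    have "{z \<in> Y \<times> Y. R x z} = (\<Union>l\<in>{..<6}. K l \<times> K l)"
      by (auto simp: R_def K_def sextic_class_def)
    also have "card \<dots> = (\<Sum>l<6. card (K l \<times> K l))"
      using fin by (intro card_UN_disjoint) (auto simp: K_def)
    finally show ?thesis
      by (simp add: a_def K_def power2_eq_square card_cartesian_product)
  qed
  have sum_a: "(\<Sum>l<6. a x l) \<ge> m" for x
  proof -
    have "(\<Sum>l<6. card {y \<in> Y. \<not> p dvd x + y \<and> sextic_class p g (x + y) = l})
        = card (\<Union>l\<in>{..<6}. {y \<in> Y. \<not> p dvd x + y \<and> sextic_class p g (x + y) = l})"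
      using fin by (intro card_UN_disjoint[symmetric]) auto
    also have "(\<Union>l\<in>{..<6}. {y \<in> Y. \<not> p dvd x + y \<and> sextic_class p g (x + y) = l})
        = Y - {y \<in> Y. p dvd x + y}" by (auto simp: sextic_class_def)
    also have "card \<dots> = card Y - card {y \<in> Y. p dvd x + y}"
      using fin by (intro card_Diff_subset) auto
    finally have "(\<Sum>l<6. a x l) = int (card Y - card {y \<in> Y. p dvd x + y})"
      unfolding a_def by (simp only: of_nat_sum[symmetric])
    moreover have "card {y \<in> Y. p dvd x + y} \<le> 1"
    proof -
      have "y = y'" if "y \<in> Y" "y' \<in> Y" "p dvd x + y" "p dvd x + y'" for y y'
      proof -
        have "[x + y = x + y'] (mod p)"
          using that(3,4) by (simp add: cong_def dvd_eq_mod_eq_0)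
        then have "[y = y'] (mod p)" by (simp only: cong_add_lcancel_nat)
        moreover have "y < p" "y' < p" using that XY(2) by auto
        ultimately show ?thesis by (simp add: cong_def)
      qed
      then show ?thesis by (subst card_le_Suc0_iff_eq[folded One_nat_def]) (use fin in auto)
    qed
    ultimately show ?thesis by (simp add: m_def)
  qed
  have lower: "6 * m\<^sup>2 + (if x \<in> X then m\<^sup>2 else 0) \<le> 36 * (\<Sum>l<6. (a x l)\<^sup>2)" for x
  proof -
    \<comment> \<open>This is the variance around \<open>m / 6\<close>, scaled by 36 to stay in the
      integers. The empty class \<open>l0\<close> alone contributes
      \<open>m\<^sup>2\<close>.\<close>
    have "(if x \<in> X then m\<^sup>2 else 0) \<le> (\<Sum>l<6. (6 * a x l - m)\<^sup>2)"
    proof (cases "x \<in> X")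
      case True
      then have "{y \<in> Y. \<not> p dvd x + y \<and> sextic_class p g (x + y) = l0} = {}"
        using avoid by auto
      then have "a x l0 = 0" unfolding a_def by (simp only: card.empty of_nat_0)
      then have "m\<^sup>2 = (6 * a x l0 - m)\<^sup>2" by simp
      also have "\<dots> \<le> (\<Sum>l<6. (6 * a x l - m)\<^sup>2)"
        using \<open>l0 < 6\<close> by (intro member_le_sum) auto
      finally show ?thesis using True by simp
    qed (simp add: sum_nonneg)
    also have "(\<Sum>l<6. (6 * a x l - m)\<^sup>2) = (\<Sum>l<6. 36 * (a x l)\<^sup>2 - 12 * m * a x l + m\<^sup>2)"
      by (intro sum.cong) (auto simp: power2_eq_square algebra_simps)
    also have "\<dots> = 36 * (\<Sum>l<6. (a x l)\<^sup>2) - 12 * (m * (\<Sum>l<6. a x l)) + 6 * m\<^sup>2"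
      by (simp add: sum.distrib sum_subtractf sum_distrib_left mult.assoc)
    finally have 1: "(if x \<in> X then m\<^sup>2 else 0) \<le> \<dots>" .
    have "m * m \<le> m * (\<Sum>l<6. a x l)"
      using sum_a m_nonneg by (intro mult_left_mono)
    then show ?thesis using 1 by (simp add: power2_eq_square)
  qed
  have "6 * m\<^sup>2 * int p + int (card X) * m\<^sup>2 = (\<Sum>x<p. 6 * m\<^sup>2 + (if x \<in> X then m\<^sup>2 else 0))"
    using XY by (simp add: sum.distrib sum.If_cases Int_absorb1)
  also have "\<dots> \<le> (\<Sum>x<p. 36 * (\<Sum>l<6. (a x l)\<^sup>2))" by (intro sum_mono lower)
  also have "\<dots> = 36 * int (\<Sum>x<p. card {z \<in> Y \<times> Y. R x z})"
    by (simp add: sum_sq sum_distrib_left)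
  also have "(\<Sum>x<p. card {z \<in> Y \<times> Y. R x z}) = (\<Sum>z\<in>Y \<times> Y. card {x \<in> {..<p}. R x z})"
    using fin by (intro sum_multicount_gen) auto
  \<comment> \<open>Diagonal pairs get the trivial count \<open>p\<close>. Keeping
    \<open>f - 1\<close> for them as well makes the sum split neatly.\<close>
  also have "\<dots> \<le> (\<Sum>z\<in>Y \<times> Y. (if fst z = snd z then p else 0) + (f - 1))"
  proof (rule sum_mono, clarify)
    fix y y' assume y: "y \<in> Y" "y' \<in> Y"
    show "card {x \<in> {..<p}. R x (y, y')} \<le> (if fst (y, y') = snd (y, y') then p else 0) + (f - 1)"
    proof (cases "y = y'")
      case True
      have "card {x \<in> {..<p}. R x (y, y')} \<le> card {..<p}" by (intro card_mono) auto
      then show ?thesis using True by simp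
    next
      case False
      moreover have "y < p" "y' < p" using y XY(2) by auto
      ultimately have "\<not> [y = y'] (mod p)" by (simp add: cong_def)
      then show ?thesis
        using card_same_sextic_class_le[OF assms(1-3)] False by (simp add: R_def)
    qed
  qed
  also have "\<dots> = card Y * p + (card Y)\<^sup>2 * (f - 1)"
    by (simp add: sum.distrib sum.cartesian_product' power2_eq_square fin card_cartesian_product)
  finally have "6 * m\<^sup>2 * int p + int (card X) * m\<^sup>2
      \<le> 36 * int (card Y * p + (card Y)\<^sup>2 * (f - 1))" by simp
  also have "\<dots> \<le> 36 * (int (card Y) * int p) + 6 * ((int (card Y))\<^sup>2 * int p)"
  proof -
    have "(card Y)\<^sup>2 * (6 * (f - 1)) \<le> (card Y)\<^sup>2 * p"
      using assms(2) by (intro mult_left_mono) auto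
    then have "int ((card Y)\<^sup>2 * (6 * (f - 1))) \<le> int ((card Y)\<^sup>2 * p)"
      by (simp only: of_nat_le_iff)
    then show ?thesis by (simp add: mult_ac)
  qed
  \<comment> \<open>As \<open>(card Y)\<^sup>2 - m\<^sup>2 = 2 * card Y - 1\<close>, the main terms
    differ by at most \<open>12 * card Y * p\<close>; with the diagonal this gives 48 = 36 +
    12.\<close>
  finally show ?thesis
    by (simp add: m_def power2_eq_square algebra_simps)
qed

section \<open>Hall's sequence on progressions and the complexity bound\<close>

lemma hall_sequence_eq_1_iff:
  assumes "prime p" "p = 6 * f + 1" "residue_primroot p g"
  shows "hall_sequence p g n = 1 \<longleftrightarrow> \<not> p dvd n \<and> sextic_class p g n \<in> {0, 1, 3}"
  using mem_cyclotomic_coset6_iff[OF assms, of 0 n] mem_cyclotomic_coset6_iff[OF assms, of 1 n]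
    mem_cyclotomic_coset6_iff[OF assms, of 3 n]
  by (auto simp: hall_sequence_def)

text \<open>A progression of \<open>2 * L - 1\<close> terms is the sumset of two progressions of
  \<open>L\<close> terms, since \<open>j + j'\<close> runs up to \<open>2 * L - 2\<close>.\<close>

lemma hall_sequence_constant_progression:
  assumes "prime p" "p = 6 * f + 1" "residue_primroot p g"
    and t: "0 < t" "t < p" and L: "0 < L" "L \<le> p"
    and const: "\<And>k. k < 2 * L - 1 \<Longrightarrow> hall_sequence p g (n + k * t) = hall_sequence p g n"
  shows "real L \<le> 8 * sqrt (real p)"
proof -
  define X where "X = (\<lambda>j. (n + j * t) mod p) ` {..<L}"
  define Y where "Y = (\<lambda>j. (j * t) mod p) ` {..<L}"
  have cop: "coprime t p"
    using t assms(1) by (metis coprime_commute nat_dvd_not_less prime_imp_coprime)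
  have inj: "j = j'" if "[j * t = j' * t] (mod p)" "j < L" "j' < L" for j j'
    using that L cop cong_mult_rcancel_nat[of t p j j'] by (auto simp: cong_def)
  have card: "card X = L" "card Y = L"
  proof -
    have "inj_on (\<lambda>j. (n + j * t) mod p) {..<L}"
    proof (rule inj_onI)
      fix j j' assume j: "j \<in> {..<L}" "j' \<in> {..<L}" "(n + j * t) mod p = (n + j' * t) mod p"
      then have "[n + j * t = n + j' * t] (mod p)" by (simp only: cong_def)
      then have "[j * t = j' * t] (mod p)" by (simp only: cong_add_lcancel_nat)
      then show "j = j'" using j by (intro inj) auto
    qed
    then show "card X = L" by (simp add: X_def card_image)
    have "inj_on (\<lambda>j. (j * t) mod p) {..<L}"
      by (rule inj_onI, rule inj) (simp_all add: cong_def)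
    then show "card Y = L" by (simp add: Y_def card_image)
  qed
  \<comment> \<open>The value 1 excludes class 2, and the value 0 away from multiples of
    \<open>p\<close> excludes class 0.\<close>
  define l where "l = (if hall_sequence p g n = 1 then 2 else 0 :: nat)"
  have avoid: "sextic_class p g (x + y) \<noteq> l" if xy: "x \<in> X" "y \<in> Y" "\<not> p dvd x + y" for x y
  proof -
    obtain j j' where j: "j < L" "j' < L" "x = (n + j * t) mod p" "y = (j' * t) mod p"
      using xy(1,2) unfolding X_def Y_def by blast
    have "(x + y) mod p = (n + (j + j') * t) mod p"
      unfolding j(3,4) mod_add_eq by (simp add: algebra_simps)
    then have "hall_sequence p g (x + y) = hall_sequence p g (n + (j + j') * t)"
      by (simp add: hall_sequence_def)
    also have "\<dots> = hall_sequence p g n" using j by (intro const) auto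
    finally have "hall_sequence p g (x + y) = 1 \<longleftrightarrow> hall_sequence p g n = 1" by simp
    then show ?thesis
      using xy(3) hall_sequence_eq_1_iff[OF assms(1-3), of "x + y"] by (auto simp: l_def)
  qed
  have p0: "p > 0" using t by simp
  have "int L * (int L - 1)\<^sup>2 \<le> 48 * int L * int p"
  proof -
    have "X \<subseteq> {..<p}" "Y \<subseteq> {..<p}" "l < 6"
      using p0 by (auto simp: X_def Y_def l_def)
    moreover have "Y \<noteq> {}" using card(2) L(1) by auto
    ultimately show ?thesis
      using card_sumset_avoiding_sextic_class[OF assms(1-3), of X Y l, unfolded card] avoid
      by blast
  qed
  then have "int L * (int L - 1)\<^sup>2 \<le> int L * (48 * int p)" by (simp add: mult_ac)
  then have "(int L - 1)\<^sup>2 \<le> 48 * int p" using L(1) by simp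
  then have "real_of_int ((int L - 1)\<^sup>2) \<le> real_of_int (48 * int p)"
    by (simp only: of_int_le_iff)
  then have "(real L - 1)\<^sup>2 \<le> 48 * real p" by simp
  \<comment> \<open>48 is rounded up to the square 49; the remaining 1 is absorbed by
    \<open>sqrt p\<close>, giving 8.\<close>
  also have "\<dots> \<le> (7 * sqrt (real p))\<^sup>2" by (simp add: power_mult_distrib)
  finally have "real L - 1 \<le> 7 * sqrt (real p)"
    by (rule power2_le_imp_le) simp
  moreover have "1 \<le> sqrt (real p)" using p0 by simp
  ultimately show ?thesis by linarith
qed

lemma hall_sequence_feedback_bound:
  assumes "prime p" "p = 6 * f + 1" "residue_primroot p g"
    and "has_feedback_poly (hall_sequence p g) N M"
  shows "real (min N p) \<le> 19 * 2 ^ M * sqrt (real p)"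
proof -
  let ?h = "hall_sequence p g"
  define B where "B = min N p"
  define T where "T = (2::nat) ^ M"
  \<comment> \<open>With \<open>i + t \<le> T\<close>, the last term
    \<open>i + (2 * L - 2) * t\<close> is below \<open>2 * T * L \<le> B - T\<close> when
    \<open>L > 0\<close>. In that case also \<open>t \<le> T < B \<le> p\<close>, so
    \<open>t\<close> is invertible modulo \<open>p\<close>.\<close>
  define L where "L = (B - T) div (2 * T)"
  have T: "T > 0" by (simp add: T_def)
  have p1: "1 \<le> sqrt (real p)" using assms(2) by simp
  have Lle: "real L \<le> 8 * sqrt (real p)"
  proof (cases "L = 0")
    case False
    then have LB: "2 * T * L \<le> B - T" "L > 0" by (auto simp: L_def)
    have "2 * T \<le> 2 * T * L" using LB(2) by simp
    then have TB: "T < B" using LB T by linarith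
    obtain i t where it: "0 < t" "i + t \<le> T" "\<And>n. i \<le> n \<Longrightarrow> n + t < N \<Longrightarrow> ?h (n + t) = ?h n"
      using eventually_periodic_if_feedback_poly[OF assms(4)] by (auto simp: T_def)
    have "?h (i + k * t) = ?h i" if "k < 2 * L - 1" for k
      using that
    proof (induction k)
      case (Suc k)
      have "i + Suc k * t \<le> T + (2 * L - 2) * T"
        using Suc.prems it by (intro add_mono mult_mono) auto
      also have "\<dots> < 2 * T * L"
        using T LB(2) by (cases L) (auto simp: algebra_simps)
      finally have "i + k * t + t < N" using LB(1) by (simp add: B_def algebra_simps)
      then have "?h (i + k * t + t) = ?h (i + k * t)" by (intro it) auto
      then show ?case using Suc by (simp add: algebra_simps)
    qed simp
    moreover have "t < p" using TB it by (simp add: B_def)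
    moreover have "L \<le> 2 * T * L" using T by simp
    then have "L \<le> p" using LB(1) unfolding B_def by linarith
    ultimately show ?thesis
      using hall_sequence_constant_progression[OF assms(1-3), of t L i] it(1) LB(2) by blast
  qed simp
  have "B - T < 2 * T * (L + 1)"
    using T dividend_less_times_div[of "2 * T" "B - T"] by (simp add: L_def)
  then have "B \<le> T * (2 * L + 3)" by (simp add: algebra_simps)
  then have "real B \<le> real (T * (2 * L + 3))" by (simp only: of_nat_le_iff)
  also have "\<dots> = real T * (2 * real L + 3)" by simp
  \<comment> \<open>19 = 2 * 8 + 3, using \<open>sqrt p \<ge> 1\<close>.\<close>
  also have "\<dots> \<le> real T * (19 * sqrt (real p))"
    using Lle p1 by (intro mult_left_mono) linarith+
  finally show ?thesis by (simp add: B_def T_def mult_ac)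
qed

theorem corollary1:
  "\<exists>c::real. c > 0 \<and>
     (\<forall>(p::nat) (f::nat) (g::nat) (N::nat).
        prime p \<longrightarrow> p = 6 * f + 1 \<longrightarrow> residue_primroot p g \<longrightarrow> N \<ge> 1 \<longrightarrow>
        ln (real (min N p) / (sqrt (real p) * (ln (real p))\<^sup>2))
          \<le> c * real (max_order_complexity (hall_sequence p g) N))"
proof (intro exI[of _ "ln 38"] conjI allI impI)
  fix p f g N :: nat
  assume A: "prime p" "p = 6 * f + 1" "residue_primroot p g" "N \<ge> 1"
  define M where "M = max_order_complexity (hall_sequence p g) N"
  have "0 < M \<and> has_feedback_poly (hall_sequence p g) N M"
    unfolding M_def max_order_complexity_def
    by (rule LeastI[of _ N]) (use A(4) in \<open>auto intro: has_feedback_poly_trivial\<close>)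
  then have M: "M \<ge> 1" "real (min N p) \<le> 19 * 2 ^ M * sqrt (real p)"
    using hall_sequence_feedback_bound[OF A(1-3)] by auto
  have "f \<noteq> 0" using A by (cases "f = 0") auto
  then have p7: "real p \<ge> 7" using A(2) by simp
  have "exp 1 \<le> real p" using exp_le p7 by linarith
  then have ln1: "ln (real p) \<ge> 1" using p7 by (subst ln_ge_iff) auto
  have pos: "0 < real (min N p)" using A p7 by simp
  have "real (min N p) / (sqrt (real p) * (ln (real p))\<^sup>2) \<le> real (min N p) / (sqrt (real p) * 1)"
    using p7 ln1 by (intro divide_left_mono mult_left_mono mult_pos_pos) auto
  also have "\<dots> \<le> 19 * 2 ^ M"
    using M(2) p7 by (simp add: divide_le_eq)
  \<comment> \<open>\<open>M \<ge> 1\<close> lets the constant 19 be absorbed into the power, whence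
    the constant \<open>ln 38\<close>.\<close>
  also have "\<dots> \<le> 19 ^ M * 2 ^ M"
    using M(1) self_le_power[of "19::real" M] by (intro mult_right_mono) auto
  also have "\<dots> = (38::real) ^ M" by (simp flip: power_mult_distrib)
  finally have "ln (real (min N p) / (sqrt (real p) * (ln (real p))\<^sup>2)) \<le> ln (38 ^ M)"
    using pos p7 ln1 by (intro ln_mono divide_pos_pos mult_pos_pos) auto
  also have "\<dots> = ln 38 * real M" by (simp add: ln_realpow)
  finally show "ln (real (min N p) / (sqrt (real p) * (ln (real p))\<^sup>2))
      \<le> ln 38 * real (max_order_complexity (hall_sequence p g) N)" by (simp add: M_def)
qed simp

end
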